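(* Let $\varphi:\mathbb{N}\to(0,+\infty)$ be a monotonically increasing function with $\lim_{n\to\infty}\varphi(n)=+\infty$, and let \[ E_{\max}^\varphi=\left\{x\in [0,1]:\liminf_{n\to\infty}\frac{r_n(x)}{\varphi(n)}=0,\ \limsup_{n\to\infty}\frac{r_n(x)}{\varphi(n)}=+\infty\right\}, \] where $r_n(x)$ is the run-length function of $x$. (1) If $\limsup_{n\to\infty}\frac{n}{\varphi(n)}=+\infty$, then $\dim_H E_{\max}^\varphi=1$. (2) If $\limsup_{n\to\infty}\frac{n}{\varphi(n)}<+\infty$, then $\dim_H E_{\max}^\varphi=0$.
   Context: $\mathbb{N}=\{1,2,3,\ldots\}$. Every $x\in[0,1]$ admits a dyadic expansion $x=\sum_{k=1}^\infty x_k 2^{-k}$ with $x_k\in\{0,1\}$ for all $k\ge1$; the sequence $(x_1,x_2,\ldots)$ is called the digit sequence of $x$. (For the countably many $x$ having two dyadic expansions, one of them is fixed, arbitrarily, as the digit sequence of $x$.) For $n\ge1$ and $x\in[0,1]$, the run-length function $r_n(x)$ is the length of the longest run of $1$'s among the first $n$ digits $(x_1,\ldots,x_n)$: \[ r_n(x)=\max\{\ell\ge 0:\ x_{i+1}=\cdots=x_{i+\ell}=1\ \text{for some } 0\le i\le n-\ell\}, \] so $r_n(x)=0$ if $x_1=\cdots=x_n=0$. $\dim_H$ denotes Hausdorff dimension of subsets of $[0,1]$ with the usual metric, with the convention $\dim_H\emptyset=0$. *)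

theory Defs
  imports "HOL-Analysis.Analysis"
begin

(* The s-th power of the diameter, with the usual conventions for s = 0: a nonempty set counts 1
   (note that 0 powr 0 = 0 in HOL) and the empty set counts 0. *)
definition diam_power :: "real \<Rightarrow> 'a::metric_space set \<Rightarrow> ennreal" where
  "diam_power s U =
     (if U = {} then 0 else if s = 0 then 1 else ennreal (diameter U powr s))"

(* Boundedness is required explicitly because diameter is unspecified on unbounded sets.
   Finite covers are included, as the U i may be empty. *)
definition delta_cover :: "real \<Rightarrow> 'a::metric_space set \<Rightarrow> (nat \<Rightarrow> 'a set) \<Rightarrow> bool" where
  "delta_cover \<delta> A U \<longleftrightarrow> A \<subseteq> (\<Union>i. U i) \<and> (\<forall>i. bounded (U i) \<and> diameter (U i) \<le> \<delta>)"

definition hausdorff_premeasure :: "real \<Rightarrow> real \<Rightarrow> 'a::metric_space set \<Rightarrow> ennreal" where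
  "hausdorff_premeasure s \<delta> A = (INF U \<in> {U. delta_cover \<delta> A U}. \<Sum>i. diam_power s (U i))"

definition hausdorff_measure :: "real \<Rightarrow> 'a::metric_space set \<Rightarrow> ennreal" where
  "hausdorff_measure s A = (SUP \<delta> \<in> {0<..}. hausdorff_premeasure s \<delta> A)"

definition hausdorff_dim :: "'a::metric_space set \<Rightarrow> ennreal" where
  "hausdorff_dim A = (INF s \<in> {s. 0 \<le> s \<and> hausdorff_measure s A = 0}. ennreal s)"

(* Digits are indexed from 1; the value a 0 is irrelevant here and in run_length. *)
definition is_digit_sequence :: "(nat \<Rightarrow> nat) \<Rightarrow> real \<Rightarrow> bool" where
  "is_digit_sequence a x \<longleftrightarrow>
     (\<forall>k\<ge>1. a k \<in> {0, 1}) \<and> (\<lambda>k. real (a (Suc k)) / 2 ^ Suc k) sums x"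

definition run_length :: "(nat \<Rightarrow> nat) \<Rightarrow> nat \<Rightarrow> nat" where
  "run_length a n = Max {l. \<exists>i. i + l \<le> n \<and> (\<forall>j\<in>{1..l}. a (i + j) = 1)}"

(* The function d assigns to each x in [0,1] its chosen digit sequence. *)
definition E_max :: "(real \<Rightarrow> nat \<Rightarrow> nat) \<Rightarrow> (nat \<Rightarrow> real) \<Rightarrow> real set" where
  "E_max d \<phi> = {x \<in> {0..1}.
     liminf (\<lambda>n. ereal (real (run_length (d x) n) / \<phi> n)) = 0 \<and>
     limsup (\<lambda>n. ereal (real (run_length (d x) n) / \<phi> n)) = \<infinity>}"

end

theory Submission
  imports Defs
begin

text \<open>
  If \<open>n / \<phi> n\<close> is bounded, then so is \<open>r\<^sub>n / \<phi> n\<close>, because a run cannot be longer than \<open>n\<close>; the set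
  is then empty.

  Suppose that \<open>n / \<phi> n\<close> is unbounded. The set lies in the unit interval, so only the lower bound on
  its dimension is at stake, and it is enough to show that for every \<open>s < 1\<close> the \<open>s\<close>-dimensional
  Hausdorff measure is not zero. The set contains a large Cantor set. Fix an integer \<open>q\<close>
  with \<open>s \<le> 1 - 2 / q\<close>. Prescribe the digit 1 on very sparse blocks of positions and the digit 0
  at every other multiple of \<open>q\<close>, and leave the remaining digits free. Two things happen
  alternately:

  \<^item> A block of length \<open>L\<close> ends at some \<open>n\<close> with \<open>L / \<phi> n\<close> large. Since \<open>n / \<phi> n\<close> is
    unbounded, \<open>n\<close> can be chosen so that \<open>L / n\<close> is nevertheless small.
  \<^item> After this block no further one is inserted until a time \<open>m\<close> at which \<open>\<phi> m\<close> is much larger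
    than \<open>n + q\<close>. A run that ends by the time \<open>m\<close> is no longer than \<open>n + q\<close>, because beyond \<open>n\<close>
    the zeros at the multiples of \<open>q\<close> interrupt it. Hence \<open>r\<^sub>m / \<phi> m\<close> is small.

  So every such digit sequence has lower limit 0 and upper limit infinity (lemma
  \<open>weave_liminf_limsup\<close>; the blocks come from \<open>sparse_runs_exist\<close>). Zeros and ones both occur
  infinitely often in it, hence it is the only expansion of its value and no choice of digit
  sequences can replace it by another one.

  For the size of the Cantor set, write the digits of an arbitrary \<open>y\<close> in the unit interval into the
  free positions and let \<open>h y\<close> be the number obtained. At most a fraction \<open>2 / q\<close> of the first \<open>m\<close>
  positions is prescribed, for every \<open>m\<close>. If \<open>h y\<close> and \<open>h z\<close> first differ at the position \<open>m\<close>, then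
  \<open>y\<close> and \<open>z\<close> agree in about the first \<open>s * m\<close> digits, so their distance is at most about the \<open>s\<close>-th
  power of \<open>1 / 2 ^ m\<close>. On the other hand \<open>h y\<close> and \<open>h z\<close> share a prescribed digit among the \<open>q\<close>
  positions after \<open>m\<close>, which keeps them at distance at least \<open>1 / 2 ^ (m + q)\<close>. So the inverse
  of \<open>h\<close> is Hoelder continuous of exponent \<open>s\<close> and maps the Cantor set onto an interval (lemma
  \<open>weave_hoelder\<close>); such a map cannot exist on a set of \<open>s\<close>-dimensional measure zero (lemma
  \<open>hausdorff_measure_pos_of_hoelder_inverse\<close>).
\<close>

section \<open>Hausdorff measure\<close>

lemma hausdorff_premeasure_le:
  assumes "delta_cover \<delta> A U"
  shows "hausdorff_premeasure s \<delta> A \<le> (\<Sum>i. diam_power s (U i))"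
  unfolding hausdorff_premeasure_def using assms by (auto intro: INF_lower)

lemma hausdorff_dim_empty: "hausdorff_dim ({} :: real set) = 0"
proof -
  have "hausdorff_premeasure 0 \<delta> ({} :: real set) = 0" if "\<delta> > 0" for \<delta>
  proof -
    have "delta_cover \<delta> ({} :: real set) (\<lambda>_. {})"
      using that by (simp add: delta_cover_def)
    from hausdorff_premeasure_le[OF this, of 0] show ?thesis
      by (simp add: diam_power_def)
  qed
  hence "hausdorff_measure 0 ({} :: real set) = 0"
    by (simp add: hausdorff_measure_def SUP_eq_const)
  hence "hausdorff_dim ({} :: real set) \<le> ennreal 0"
    unfolding hausdorff_dim_def by (intro INF_lower) simp
  thus ?thesis by simp
qed

text \<open>
  The interval is covered by \<open>n\<close> intervals of length \<open>1 / n\<close>, and \<open>n * (1 / n) powr s\<close> tends to 0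
  when \<open>s > 1\<close>.
\<close>
lemma hausdorff_measure_unit_interval_eq_0:
  fixes E :: "real set"
  assumes "E \<subseteq> {0..1}" and "s > 1"
  shows "hausdorff_measure s E = 0"
proof -
  have "hausdorff_premeasure s \<delta> E = 0" if "\<delta> > 0" for \<delta>
  proof -
    have bound: "hausdorff_premeasure s \<delta> E \<le> ennreal (real n powr (1 - s))"
      if n: "n \<ge> 1" "1 / real n \<le> \<delta>" for n
    proof -
      define U where "U i = (if i < n then {real i / n..real (Suc i) / n} else {})" for i
      have diam: "diameter (U i) = (if i < n then 1 / n else 0)" for i
        using n(1) by (auto simp: U_def field_simps diameter_closed_interval divide_right_mono
            diff_divide_distrib[symmetric])
      have "x \<in> (\<Union>i. U i)" if "x \<in> E" for x
      proof (cases "x = 1")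
        case True
        have "x \<in> U (n - 1)" using n(1) True by (auto simp: U_def field_simps)
        thus ?thesis by blast
      next
        case False
        have x: "0 \<le> x" "x < 1" using that assms(1) False by auto
        define i where "i = nat \<lfloor>real n * x\<rfloor>"
        have i: "real i \<le> n * x" "n * x < real i + 1"
          using x by (auto simp: i_def)
        have "real n * x < real n * 1" using x n(1) by (intro mult_strict_left_mono) auto
        hence "i < n" using i(1) by linarith
        hence "x \<in> U i" using i n(1) by (auto simp: U_def field_simps)
        thus ?thesis by blast
      qed
      hence "delta_cover \<delta> E U"
        unfolding delta_cover_def diam using n \<open>\<delta> > 0\<close> by (auto simp: U_def)
      hence "hausdorff_premeasure s \<delta> E \<le> (\<Sum>i. diam_power s (U i))"
        by (rule hausdorff_premeasure_le)
      also have "\<dots> = (\<Sum>i<n. diam_power s (U i))"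
        by (rule suminf_finite) (auto simp: U_def diam_power_def)
      also have "\<dots> \<le> (\<Sum>i<n. ennreal ((1 / n) powr s))"
        using \<open>s > 1\<close> by (intro sum_mono) (auto simp: diam_power_def diam)
      also have "\<dots> = ennreal (real n * (1 / n) powr s)"
        by (simp add: ennreal_mult' ennreal_of_nat_eq_real_of_nat)
      also have "real n * (1 / n) powr s = real n powr (1 - s)"
        using n(1) by (simp add: powr_diff powr_divide)
      finally show ?thesis .
    qed
    have "((\<lambda>n. real n powr (1 - s)) \<longlongrightarrow> 0) sequentially"
      using \<open>s > 1\<close> by (intro tendsto_neg_powr filterlim_real_sequentially) auto
    hence "((\<lambda>n. ennreal (real n powr (1 - s))) \<longlongrightarrow> ennreal 0) sequentially"
      by (intro tendsto_ennrealI)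
    moreover have "\<forall>\<^sub>F n in sequentially. hausdorff_premeasure s \<delta> E \<le> ennreal (real n powr (1 - s))"
    proof -
      have "\<forall>\<^sub>F n in sequentially. 1 / real n < \<delta>"
        using order_tendstoD(2)[OF lim_1_over_n \<open>\<delta> > 0\<close>] by simp
      thus ?thesis using eventually_ge_at_top[of 1]
        by eventually_elim (use bound in auto)
    qed
    ultimately have "hausdorff_premeasure s \<delta> E \<le> ennreal 0"
      by (intro tendsto_lowerbound) auto
    thus ?thesis by simp
  qed
  thus ?thesis by (simp add: hausdorff_measure_def SUP_eq_const)
qed

lemma hausdorff_dim_unit_interval_le_1:
  fixes E :: "real set"
  assumes "E \<subseteq> {0..1}"
  shows "hausdorff_dim E \<le> 1"
proof (rule ennreal_le_epsilon)
  fix e :: real assume "0 < e"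
  have "hausdorff_dim E \<le> ennreal (1 + e)"
    unfolding hausdorff_dim_def
    using hausdorff_measure_unit_interval_eq_0[OF assms, of "1 + e"] \<open>0 < e\<close>
    by (intro INF_lower) auto
  thus "hausdorff_dim E \<le> 1 + ennreal e" using \<open>0 < e\<close> by simp
qed

text \<open>
  This replaces the mass distribution principle: instead of a measure on \<open>E\<close> it uses Lebesgue measure
  on the interval that parametrises a part of \<open>E\<close>. Pulled back along \<open>h\<close>, a member \<open>U\<close> of a cover
  becomes a set inside an interval of length \<open>2 * C * diam_power s U\<close>. These intervals cover
  \<open>{0..1}\<close>, so their lengths add up to at least 1.
\<close>
lemma hausdorff_measure_pos_of_hoelder_inverse:
  fixes E :: "'a::metric_space set" and h :: "real \<Rightarrow> 'a"
  assumes "C > 0" and image: "h ` {0..1} \<subseteq> E"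
    and hoelder: "\<And>y z. y \<in> {0..1} \<Longrightarrow> z \<in> {0..1} \<Longrightarrow>
                    \<bar>y - z\<bar> \<le> C * dist (h y) (h z) powr s"
    and "s \<ge> 0"
  shows "hausdorff_measure s E \<noteq> 0"
proof -
  have lower: "1 \<le> ennreal (2 * C) * (\<Sum>i. diam_power s (U i))" if U: "delta_cover 1 E U" for U
  proof -
    define V where "V i = {y \<in> {0..1}. h y \<in> U i}" for i
    \<comment> \<open>The sets \<open>V i\<close> need not be measurable, so they are enlarged to closed intervals \<open>B i\<close>.\<close>
    have "\<exists>B \<in> sets lborel. V i \<subseteq> B \<and> emeasure lborel B \<le> ennreal (2 * C) * diam_power s (U i)" for i
    proof (cases "V i = {}")
      case True
      thus ?thesis by (intro bexI[of _ "{}"]) auto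
    next
      case False
      then obtain z where z: "z \<in> V i" by blast
      \<comment> \<open>For \<open>s = 0\<close> and a one-point \<open>U i\<close>, \<open>powr\<close> gives 0 where \<open>diam_power\<close> counts 1.\<close>
      define D where "D = (if s = 0 then 1 else diameter (U i) powr s)"
      have D: "diam_power s (U i) = ennreal D" "D \<ge> 0"
        using z by (auto simp: diam_power_def D_def V_def)
      have "\<bar>y - z\<bar> \<le> C * D" if "y \<in> V i" for y
      proof -
        have "dist (h y) (h z) \<le> diameter (U i)"
          using U that z by (intro diameter_bounded_bound) (auto simp: delta_cover_def V_def)
        hence "dist (h y) (h z) powr s \<le> D"
          using \<open>s \<ge> 0\<close> by (auto simp: D_def intro: powr_mono2)
        thus ?thesis using hoelder[of y z] that z \<open>C > 0\<close>
          by (smt (verit, best) V_def mem_Collect_eq mult_left_mono)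
      qed
      hence "V i \<subseteq> {z - C * D..z + C * D}" by (auto simp: abs_le_iff algebra_simps; smt (verit))
      moreover have "emeasure lborel {z - C * D..z + C * D} = ennreal (2 * C) * diam_power s (U i)"
        using D \<open>C > 0\<close> by (simp add: ennreal_mult[symmetric] mult_ac)
      ultimately show ?thesis by (intro bexI[of _ "{z - C * D..z + C * D}"]) auto
    qed
    then obtain B where B: "\<And>i. B i \<in> sets lborel" "\<And>i. V i \<subseteq> B i"
      "\<And>i. emeasure lborel (B i) \<le> ennreal (2 * C) * diam_power s (U i)" by metis
    have "{0..1} \<subseteq> (\<Union>i. V i)"
      using U image by (fastforce simp: delta_cover_def V_def)
    hence "{0..1} \<subseteq> (\<Union>i. B i)" using B(2) by blast
    hence "emeasure lborel {0..1::real} \<le> emeasure lborel (\<Union>i. B i)"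
      using B(1) by (intro emeasure_mono) auto
    also have "\<dots> \<le> (\<Sum>i. emeasure lborel (B i))"
      using B(1) by (intro emeasure_subadditive_countably) auto
    also have "\<dots> \<le> (\<Sum>i. ennreal (2 * C) * diam_power s (U i))"
      by (intro suminf_le B(3)) auto
    finally show ?thesis by (simp add: ennreal_suminf_cmult)
  qed
  have "ennreal (1 / (2 * C)) \<le> hausdorff_premeasure s 1 E"
    unfolding hausdorff_premeasure_def
  proof (intro INF_greatest)
    fix U assume "U \<in> {U. delta_cover 1 E U}"
    hence "1 \<le> ennreal (2 * C) * (\<Sum>i. diam_power s (U i))" using lower by blast
    hence "ennreal (1 / (2 * C)) * 1
        \<le> ennreal (1 / (2 * C)) * (ennreal (2 * C) * (\<Sum>i. diam_power s (U i)))"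
      by (rule mult_left_mono) simp
    also have "\<dots> = (\<Sum>i. diam_power s (U i))"
      using \<open>C > 0\<close> by (simp add: mult.assoc[symmetric] ennreal_mult[symmetric])
    finally show "ennreal (1 / (2 * C)) \<le> (\<Sum>i. diam_power s (U i))" by simp
  qed
  also have "\<dots> \<le> hausdorff_measure s E"
    unfolding hausdorff_measure_def by (intro SUP_upper) auto
  finally show ?thesis using \<open>C > 0\<close> by (auto simp: ennreal_eq_0_iff)
qed

section \<open>Dyadic expansions\<close>

lemma is_digit_sequence_le_1:
  assumes "is_digit_sequence a x" and "k \<ge> 1"
  shows "a k \<le> 1"
proof -
  have "a k \<in> {0, 1}" using assms unfolding is_digit_sequence_def by blast
  thus ?thesis by auto
qed

lemma sums_half_powers: "(\<lambda>k. 1 / 2 ^ (k + Suc m)) sums (1 / 2 ^ m :: real)"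
proof -
  have "(\<lambda>k. (1 / 2 ^ Suc m) * (1 / 2) ^ k) sums ((1 / 2 ^ Suc m) * (1 / (1 - 1 / 2)) :: real)"
    by (intro sums_mult geometric_sums) simp
  thus ?thesis by (simp add: power_add power_divide mult_ac)
qed

lemma digit_sequence_tail_sums:
  assumes a: "is_digit_sequence a x" and b: "is_digit_sequence b y"
    and agree: "\<And>k. 1 \<le> k \<Longrightarrow> k \<le> m \<Longrightarrow> a k = b k"
  shows "(\<lambda>k. (real (b (k + Suc m)) - real (a (k + Suc m))) / 2 ^ (k + Suc m)) sums (y - x)"
proof -
  have "(\<lambda>k. real (b (Suc k)) / 2 ^ Suc k - real (a (Suc k)) / 2 ^ Suc k) sums (y - x)"
    using a b unfolding is_digit_sequence_def by (intro sums_diff) auto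
  from sums_split_initial_segment[OF this, of m] show ?thesis
    using agree by (simp add: diff_divide_distrib)
qed

lemma digit_sequence_close:
  assumes a: "is_digit_sequence a x" and b: "is_digit_sequence b y"
    and agree: "\<And>k. 1 \<le> k \<Longrightarrow> k \<le> m \<Longrightarrow> a k = b k"
  shows "\<bar>x - y\<bar> \<le> 1 / 2 ^ m"
proof -
  have one_sided: "y - x \<le> 1 / 2 ^ m"
    if "is_digit_sequence a x" "is_digit_sequence b y" "\<And>k. 1 \<le> k \<Longrightarrow> k \<le> m \<Longrightarrow> a k = b k"
    for a b x y
  proof (rule sums_le[OF _ digit_sequence_tail_sums[OF that] sums_half_powers])
    fix k
    have "b (k + Suc m) \<le> 1" using that(2) by (rule is_digit_sequence_le_1) simp
    thus "(real (b (k + Suc m)) - real (a (k + Suc m))) / 2 ^ (k + Suc m) \<le> 1 / 2 ^ (k + Suc m)"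
      by (intro divide_right_mono) auto
  qed auto
  show ?thesis using one_sided[OF a b agree] one_sided[OF b a] agree by (simp add: abs_le_iff)
qed

text \<open>
  The difference \<open>1 / 2 ^ m\<close> made by the digit at \<open>m\<close> could be cancelled only if at every later
  position \<open>a\<close> had the digit 1 and \<open>b\<close> the digit 0. A single position \<open>p\<close> where this is not so
  saves \<open>1 / 2 ^ p\<close>. The lemma serves both to separate the points of the Cantor set and to prove
  uniqueness of expansions.
\<close>
lemma digit_sequence_gap:
  assumes a: "is_digit_sequence a x" and b: "is_digit_sequence b y"
    and agree: "\<And>k. 1 \<le> k \<Longrightarrow> k < m \<Longrightarrow> a k = b k"
    and "1 \<le> m" "a m = 0" "b m = 1"
    and "m < p" "a p \<le> b p"
  shows "1 / 2 ^ p \<le> y - x"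
proof -
  define c where "c k = (real (b k) - real (a k)) / 2 ^ k" for k
  have "(\<lambda>k. c (k + m)) sums (y - x)"
    using digit_sequence_tail_sums[OF a b, of "m - 1"] agree \<open>1 \<le> m\<close> by (simp add: c_def)
  from sums_split_initial_segment[OF this, of 1]
  have "(\<lambda>k. c (k + Suc m)) sums (y - x - 1 / 2 ^ m)"
    using \<open>a m = 0\<close> \<open>b m = 1\<close> by (simp add: c_def)
  \<comment> \<open>Adding the geometric tail makes every term nonnegative, so a single term bounds the sum.\<close>
  from sums_add[OF this sums_half_powers[of m]]
  have sums: "(\<lambda>k. c (k + Suc m) + 1 / 2 ^ (k + Suc m)) sums (y - x)" by simp
  have nonneg: "0 \<le> c k + 1 / 2 ^ k" if "k \<ge> 1" for k
    using is_digit_sequence_le_1[OF a that]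
    by (simp add: c_def add_divide_distrib[symmetric])
  have "1 / 2 ^ p \<le> c p + 1 / 2 ^ p"
    using \<open>a p \<le> b p\<close> by (simp add: c_def)
  also have "\<dots> = (\<Sum>k\<in>{p - Suc m}. c (k + Suc m) + 1 / 2 ^ (k + Suc m))"
    using \<open>m < p\<close> by simp
  also have "\<dots> \<le> (\<Sum>k. c (k + Suc m) + 1 / 2 ^ (k + Suc m))"
    using sums by (intro sum_le_suminf nonneg) (auto simp: sums_iff)
  finally show ?thesis using sums by (simp add: sums_iff)
qed

lemma first_difference:
  fixes a b :: "nat \<Rightarrow> 'a"
  assumes "k \<ge> 1" "a k \<noteq> b k"
  obtains m where "m \<ge> 1" "a m \<noteq> b m" "\<And>k. 1 \<le> k \<Longrightarrow> k < m \<Longrightarrow> a k = b k"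
proof -
  define m where "m = (LEAST m. m \<ge> 1 \<and> a m \<noteq> b m)"
  have "m \<ge> 1 \<and> a m \<noteq> b m" unfolding m_def
    using assms by (intro LeastI[of "\<lambda>m. m \<ge> 1 \<and> a m \<noteq> b m" k] conjI)
  moreover have "a k = b k" if "1 \<le> k" "k < m" for k
    using not_less_Least[of k "\<lambda>m. m \<ge> 1 \<and> a m \<noteq> b m"] that by (auto simp: m_def)
  ultimately show ?thesis using that by blast
qed

text \<open>
  Two expansions of one number differ as \<open>0111...\<close> and \<open>1000...\<close> do from some position on. This is
  impossible if one of them contains both digits infinitely often.
\<close>
lemma digit_sequence_unique:
  assumes a: "is_digit_sequence a x" and b: "is_digit_sequence b x"
    and zeros: "\<And>n. \<exists>k>n. a k = 0" and ones: "\<And>n. \<exists>k>n. a k = 1"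
    and "k \<ge> 1"
  shows "a k = b k"
proof (rule ccontr)
  assume "a k \<noteq> b k"
  then obtain m where m: "m \<ge> 1" "a m \<noteq> b m" "\<And>k. 1 \<le> k \<Longrightarrow> k < m \<Longrightarrow> a k = b k"
    using first_difference[of k a b] \<open>k \<ge> 1\<close> by metis
  have "a m \<le> 1" "b m \<le> 1" using is_digit_sequence_le_1 a b m(1) by blast+
  then consider "a m = 0" "b m = 1" | "a m = 1" "b m = 0" using m(2) by linarith
  thus False
  proof cases
    case 1
    obtain p where p: "p > m" "a p = 0" using zeros by blast
    have "1 / 2 ^ p \<le> x - x"
      by (rule digit_sequence_gap[OF a b, of m]) (use 1 p m in auto)
    moreover have "0 < 1 / (2::real) ^ p" by simp
    ultimately show False by linarith
  next
    case 2
    obtain p where p: "p > m" "a p = 1" using ones by blast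
    have "1 / 2 ^ p \<le> x - x"
      by (rule digit_sequence_gap[OF b a, of m])
        (use 2 p m is_digit_sequence_le_1[OF b, of p] in auto)
    moreover have "0 < 1 / (2::real) ^ p" by simp
    ultimately show False by linarith
  qed
qed

lemma digit_sequence_exists:
  assumes "\<And>k. k \<ge> 1 \<Longrightarrow> a k \<in> {0, 1 :: nat}"
  obtains x where "x \<in> {0..1}" "is_digit_sequence a x"
proof -
  have le: "real (a (Suc k)) / 2 ^ Suc k \<le> 1 / 2 ^ (k + Suc 0)" for k
    using assms[of "Suc k"] by auto
  have half: "(\<lambda>k. 1 / 2 ^ (k + Suc 0) :: real) sums 1"
    using sums_half_powers[of 0] by simp
  have "summable (\<lambda>k. real (a (Suc k)) / 2 ^ Suc k)"
    using le by (intro summable_comparison_test'[OF sums_summable[OF half], of 0]) simp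
  then obtain x where x: "(\<lambda>k. real (a (Suc k)) / 2 ^ Suc k) sums x"
    by (auto simp: summable_def)
  have "x \<le> 1" using sums_le[OF le x half] .
  moreover have "0 \<le> x" by (rule sums_le[OF _ sums_zero x]) simp
  ultimately show ?thesis using that x assms by (auto simp: is_digit_sequence_def)
qed

section \<open>Run lengths\<close>

lemma finite_run_lengths: "finite {l::nat. \<exists>i. i + l \<le> n \<and> (\<forall>j\<in>{1..l}. a (i + j) = (1::nat))}"
  by (rule finite_subset[of _ "{..n}"]) auto

lemma run_length_ge:
  assumes "i + l \<le> n" "\<And>j. 1 \<le> j \<Longrightarrow> j \<le> l \<Longrightarrow> a (i + j) = 1"
  shows "l \<le> run_length a n"
  unfolding run_length_def using assms by (intro Max_ge finite_run_lengths) auto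

lemma run_length_le:
  assumes "\<And>i l. i + l \<le> n \<Longrightarrow> (\<And>j. 1 \<le> j \<Longrightarrow> j \<le> l \<Longrightarrow> a (i + j) = 1) \<Longrightarrow> l \<le> B"
  shows "run_length a n \<le> B"
proof -
  have "0 \<in> {l. \<exists>i. i + l \<le> n \<and> (\<forall>j\<in>{1..l}. a (i + j) = 1)}" by auto
  hence "{l. \<exists>i. i + l \<le> n \<and> (\<forall>j\<in>{1..l}. a (i + j) = 1)} \<noteq> {}" by blast
  thus ?thesis
    unfolding run_length_def using assms by (subst Max_le_iff[OF finite_run_lengths]) auto
qed

section \<open>Inserting sparse runs into a digit sequence\<close>

lemma multiple_in_window:
  fixes q :: nat
  assumes "q > 0"
  obtains p where "q dvd p" "i < p" "p \<le> i + q"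
proof
  show "q dvd q * (i div q + 1)" by simp
  have i: "q * (i div q) + i mod q = i" by simp
  show "i < q * (i div q + 1)" using mod_less_divisor[OF assms, of i] i
    unfolding distrib_left by linarith
  show "q * (i div q + 1) \<le> i + q" by simp
qed

text \<open>
  The block of ones with index \<open>k\<close> has length \<open>L k\<close> and ends at \<open>N (Suc k)\<close>; the time \<open>M k\<close>
  lies between the end \<open>N k\<close> of the preceding block (or the start, for \<open>k = 0\<close>) and the beginning of
  this one. It is the time at which the longest run is to be short compared with \<open>\<phi>\<close>. In the
  last assumption, \<open>N k + L k\<close> bounds the number of prescribed ones up to \<open>N (Suc k)\<close>, and it has
  to be a small fraction of the position \<open>N (Suc k) - L k\<close> where the block starts: the density of
  the ones must be small at the end of a block and also at every position within it.
\<close>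
locale sparse_runs =
  fixes q :: nat and N M L :: "nat \<Rightarrow> nat"
  assumes q_pos: "q > 0"
    and N_0: "N 0 = 0"
    and N_M: "N k + q \<le> M k"
    and M_N: "M k + L k \<le> N (Suc k)"
    and L_pos: "L k > 0"
    and sparse: "q * (N k + L k) + L k \<le> N (Suc k)"
begin

definition ones :: "nat set" where
  "ones = (\<Union>k. {N (Suc k) - L k<..N (Suc k)})"

definition free :: "nat \<Rightarrow> bool" where
  "free k \<longleftrightarrow> k \<notin> ones \<and> \<not> q dvd k"

definition rank :: "nat \<Rightarrow> nat" where
  "rank m = card {k \<in> {1..m}. free k}"

text \<open>
  The multiples of \<open>q\<close> outside the blocks receive 0, and the digits \<open>b 1, b 2, ...\<close> are written in
  this order into the free positions.
\<close>
definition weave :: "(nat \<Rightarrow> nat) \<Rightarrow> nat \<Rightarrow> nat" where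
  "weave b k = (if k \<in> ones then 1 else if q dvd k then 0 else b (rank k))"

lemma strict_mono_N: "strict_mono N"
  unfolding strict_mono_Suc_iff
proof
  fix k show "N k < N (Suc k)" using N_M[of k] M_N[of k] q_pos by linarith
qed

lemma strict_mono_M: "strict_mono M"
  unfolding strict_mono_Suc_iff
proof
  fix k show "M k < M (Suc k)" using M_N[of k] N_M[of "Suc k"] q_pos by linarith
qed

lemma N_mono: "i \<le> j \<Longrightarrow> N i \<le> N j"
  using strict_mono_N by (simp add: strict_mono_less_eq)

lemma le_N: "k \<le> N k"
  using strict_mono_N by (rule strict_mono_imp_increasing)

lemma not_ones:
  assumes "N k < j" "j \<le> N (Suc k) - L k"
  shows "j \<notin> ones"
proof
  assume "j \<in> ones"
  then obtain i where i: "N (Suc i) - L i < j" "j \<le> N (Suc i)" by (auto simp: ones_def)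
  consider "Suc i \<le> k" | "i = k" | "Suc k \<le> i" by linarith
  thus False
  proof cases
    case 1 thus False using N_mono[of "Suc i" k] i assms by linarith
  next
    case 2 thus False using i assms by simp
  next
    case 3
    thus False using N_mono[of "Suc k" i] N_M[of i] M_N[of i] i assms by linarith
  qed
qed

lemma ones_run:
  assumes "N (Suc k) - L k < j" "j \<le> N (Suc k)"
  shows "j \<in> ones"
  using assms by (auto simp: ones_def)

text \<open>
  Up to the end of a block, everything before the preceding block's end is crudely counted as a one.
  The stronger bound by the start of the block, rather than by its end, is what covers the positions
  inside the block in the next lemma.
\<close>
lemma card_ones_end: "q * card (ones \<inter> {1..N (Suc k)}) \<le> N (Suc k) - L k"
proof -
  have "ones \<inter> {1..N (Suc k)} \<subseteq> {1..N k} \<union> {N (Suc k) - L k<..N (Suc k)}"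
  proof
    fix j assume "j \<in> ones \<inter> {1..N (Suc k)}"
    moreover from this have "j \<le> N k \<or> N (Suc k) - L k < j"
      using not_ones[of k j] by (meson IntD1 not_le)
    ultimately show "j \<in> {1..N k} \<union> {N (Suc k) - L k<..N (Suc k)}" by auto
  qed
  hence "card (ones \<inter> {1..N (Suc k)}) \<le> card ({1..N k} \<union> {N (Suc k) - L k<..N (Suc k)})"
    by (intro card_mono) auto
  also have "\<dots> \<le> N k + L k"
    by (intro card_Un_le[THEN order_trans]) auto
  finally have "q * card (ones \<inter> {1..N (Suc k)}) \<le> q * (N k + L k)" by simp
  thus ?thesis using sparse[of k] by linarith
qed

text \<open>
  The number of ones stays constant from \<open>N k\<close> to the start of the next block, so there the bound at
  the end \<open>N k\<close> persists; inside the block the bound for the whole block applies.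
\<close>
lemma card_ones_le: "q * card (ones \<inter> {1..m}) \<le> m"
proof (cases "m = 0")
  case False
  \<comment> \<open>The index with \<open>N k < m \<le> N (Suc k)\<close>.\<close>
  define k where "k = (LEAST k. m \<le> N (Suc k))"
  have mk: "m \<le> N (Suc k)" unfolding k_def by (rule LeastI[of _ m]) (use le_N[of "Suc m"] in simp)
  have Nk: "N k < m"
  proof (cases k)
    case (Suc i)
    thus ?thesis using not_less_Least[of i "\<lambda>k. m \<le> N (Suc k)"] by (simp add: k_def)
  qed (use False N_0 in simp)
  show ?thesis
  proof (cases "m \<le> N (Suc k) - L k")
    case True
    have "ones \<inter> {1..m} = ones \<inter> {1..N k}"
    proof (intro set_eqI iffI)
      fix j assume "j \<in> ones \<inter> {1..m}"
      thus "j \<in> ones \<inter> {1..N k}" using not_ones[of k j] True by (cases "j \<le> N k") auto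
    qed (use Nk in auto)
    moreover have "q * card (ones \<inter> {1..N k}) \<le> N k"
      using card_ones_end[of "k - 1"] N_0 by (cases k) auto
    ultimately show ?thesis using Nk by simp
  next
    case beyond: False
    have "card (ones \<inter> {1..m}) \<le> card (ones \<inter> {1..N (Suc k)})"
      using mk by (intro card_mono) auto
    hence "q * card (ones \<inter> {1..m}) \<le> q * card (ones \<inter> {1..N (Suc k)})" by simp
    thus ?thesis using card_ones_end[of k] beyond by linarith
  qed
qed auto

text \<open>
  The prescribed ones and the multiples of \<open>q\<close> each take up at most \<open>m / q\<close> of the first \<open>m\<close>
  positions. Multiplying by \<open>q\<close> avoids the division.
\<close>
lemma rank_ge: "q * m \<le> q * rank m + 2 * m"
proof -
  have "{1..m} \<subseteq> {k \<in> {1..m}. free k} \<union> (ones \<inter> {1..m}) \<union> {k \<in> {1..m}. q dvd k}"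
    by (auto simp: free_def)
  hence "card {1..m} \<le> card ({k \<in> {1..m}. free k} \<union> (ones \<inter> {1..m}) \<union> {k \<in> {1..m}. q dvd k})"
    by (intro card_mono) auto
  also have "\<dots> \<le> rank m + card (ones \<inter> {1..m}) + card {k \<in> {1..m}. q dvd k}"
    unfolding rank_def by (meson add_le_mono1 card_Un_le order_trans)
  also have "card {k \<in> {1..m}. q dvd k} \<le> card ((*) q ` {1..m div q})"
    using q_pos by (intro card_mono) (auto elim!: dvdE simp: less_eq_div_iff_mult_less_eq mult.commute)
  also have "card ((*) q ` {1..m div q}) \<le> m div q"
    using card_image_le[of "{1..m div q}" "(*) q"] by simp
  finally have "m \<le> rank m + card (ones \<inter> {1..m}) + m div q" by simp
  hence "q * m \<le> q * (rank m + card (ones \<inter> {1..m}) + m div q)" by simp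
  also have "\<dots> \<le> q * rank m + m + m"
    using card_ones_le[of m] by (simp add: distrib_left add_mono)
  finally show ?thesis by simp
qed

lemma rank_Suc: "rank (Suc m) = rank m + (if free (Suc m) then 1 else 0)"
proof -
  have "{k \<in> {1..Suc m}. free k} =
      (if free (Suc m) then insert (Suc m) {k \<in> {1..m}. free k} else {k \<in> {1..m}. free k})"
    by (auto simp: le_Suc_eq)
  thus ?thesis by (simp add: rank_def)
qed

text \<open>
  The function \<open>rank\<close> is unbounded by the density estimate and grows in steps of at most 1, so it takes
  the value \<open>j\<close>, and it takes it for the first time at a free position.
\<close>
lemma free_position:
  assumes "q > 2" "j \<ge> 1"
  obtains m where "m \<ge> 1" "free m" "rank m = j" "\<And>k. k < m \<Longrightarrow> rank k < j"
proof -
  define m where "m = (LEAST m. j \<le> rank m)"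
  have "j \<le> rank (q * j)"
  proof -
    have "q * (q * j) \<le> q * rank (q * j) + q * (2 * j)" using rank_ge[of "q * j"] by (simp add: mult_ac)
    hence "q * j \<le> rank (q * j) + 2 * j" using q_pos by (simp add: distrib_left[symmetric])
    moreover have "3 * j \<le> q * j" using assms by (intro mult_right_mono) auto
    ultimately show ?thesis by linarith
  qed
  hence m: "j \<le> rank m" unfolding m_def by (rule LeastI)
  have less: "rank k < j" if "k < m" for k
    using not_less_Least[of k "\<lambda>m. j \<le> rank m"] that by (simp add: m_def)
  have "m \<noteq> 0" using m assms(2) by (intro notI) (simp add: rank_def)
  then obtain i where i: "m = Suc i" using not0_implies_Suc by blast
  have "free m \<and> rank m = j"
    using rank_Suc[of i] less[of i] m i by (cases "free m") auto
  thus ?thesis using that[of m] less \<open>m \<noteq> 0\<close> by simp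
qed

lemma rank_pos:
  assumes "free k" "k \<ge> 1"
  shows "rank k \<ge> 1"
proof -
  have "k \<in> {k' \<in> {1..k}. free k'}" using assms by simp
  hence "rank k \<noteq> 0" unfolding rank_def by (subst card_0_eq) auto
  thus ?thesis by simp
qed

lemma weave_ones_infinite: "\<exists>k>n. weave b k = 1"
proof (intro exI conjI)
  show "N (Suc n) > n" using le_N[of "Suc n"] by simp
  have "N (Suc n) \<in> ones" using L_pos[of n] M_N[of n] by (intro ones_run[of n]) auto
  thus "weave b (N (Suc n)) = 1" by (simp add: weave_def)
qed

lemma weave_window_zero:
  assumes "N k \<le> i" "i + q \<le> M k"
  obtains p where "i < p" "p \<le> i + q" "weave b p = 0"
proof -
  obtain p where p: "q dvd p" "i < p" "p \<le> i + q" using multiple_in_window[OF q_pos] by blast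
  have "p \<notin> ones" using p assms M_N[of k] by (intro not_ones[of k]) auto
  thus ?thesis using that p by (simp add: weave_def)
qed

lemma weave_zeros_infinite: "\<exists>k>n. weave b k = 0"
proof -
  obtain p where "N n < p" "weave b p = 0"
    using weave_window_zero[of n "N n"] N_M[of n] by blast
  thus ?thesis using le_N[of n] by (intro exI[of _ p]) auto
qed

lemma weave_digit:
  assumes "is_digit_sequence b y" "k \<ge> 1"
  shows "weave b k \<in> {0, 1}"
proof -
  have "b (rank k) \<in> {0, 1}" if "free k"
  proof -
    have "rank k \<ge> 1" using that assms(2) by (rule rank_pos)
    thus ?thesis using assms(1) unfolding is_digit_sequence_def by blast
  qed
  thus ?thesis by (auto simp: weave_def free_def)
qed

lemma run_length_weave_ge:
  assumes "\<And>k. k \<ge> 1 \<Longrightarrow> a k = weave b k"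
  shows "L k \<le> run_length a (N (Suc k))"
proof (rule run_length_ge)
  show le: "N (Suc k) - L k + L k \<le> N (Suc k)" using M_N[of k] by simp
  fix j assume "1 \<le> j" "j \<le> L k"
  thus "a (N (Suc k) - L k + j) = 1"
    using assms[of "N (Suc k) - L k + j"] ones_run[of k "N (Suc k) - L k + j"] le
    by (simp add: weave_def)
qed

text \<open>
  A run may fill the whole of the first \<open>N k\<close> positions, but of the positions from there to \<open>M k\<close> it
  contains fewer than \<open>q\<close> consecutive ones.
\<close>
lemma run_length_weave_le:
  assumes "\<And>k. k \<ge> 1 \<Longrightarrow> a k = weave b k"
  shows "run_length a (M k) \<le> N k + q"
proof (rule run_length_le, rule ccontr)
  fix i l assume le: "i + l \<le> M k" and run: "\<And>j. 1 \<le> j \<Longrightarrow> j \<le> l \<Longrightarrow> a (i + j) = 1"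
    and "\<not> l \<le> N k + q"
  \<comment> \<open>Skipping \<open>N k\<close> positions of the run leaves \<open>q\<close> positions of it, all beyond \<open>N k\<close>.\<close>
  hence "N k \<le> i + N k" "i + N k + q \<le> M k" by linarith+
  then obtain p where p: "i + N k < p" "p \<le> i + N k + q" "weave b p = 0"
    by (rule weave_window_zero)
  have "a (i + (p - i)) = 1" using p \<open>\<not> l \<le> N k + q\<close> by (intro run) auto
  thus False using p assms[of p] by simp
qed

text \<open>
  If \<open>b\<close> and \<open>c\<close> first differ at \<open>j\<close>, then the woven sequences first differ at the \<open>j\<close>-th
  free position \<open>m\<close>. The density estimate gives \<open>s * m \<le> j\<close>, and a multiple \<open>p\<close> of \<open>q\<close> with
  \<open>m < p \<le> m + q\<close> carries the same prescribed digit in both sequences, which separates the two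
  numbers by \<open>1 / 2 ^ p\<close>. The factor 2 comes from agreement on only \<open>j - 1\<close> digits, and
  \<open>2 ^ q\<close> from the distance between \<open>m\<close> and \<open>p\<close>.
\<close>
lemma weave_hoelder:
  assumes b: "is_digit_sequence b y" and c: "is_digit_sequence c z"
    and u: "is_digit_sequence (weave b) u" and v: "is_digit_sequence (weave c) v"
    and s: "0 \<le> s" "real q * s \<le> real q - 2" and q: "q > 2"
  shows "\<bar>y - z\<bar> \<le> 2 * 2 ^ q * \<bar>u - v\<bar> powr s"
proof (cases "\<forall>k\<ge>1. b k = c k")
  case True
  hence "y = z" using b c by (auto simp: is_digit_sequence_def sums_iff)
  thus ?thesis by simp
next
  case False
  then obtain j where j: "j \<ge> 1" "b j \<noteq> c j" "\<And>k. 1 \<le> k \<Longrightarrow> k < j \<Longrightarrow> b k = c k"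
    using first_difference[of _ b c] by metis
  obtain m where m: "m \<ge> 1" "free m" "rank m = j" "\<And>k. k < m \<Longrightarrow> rank k < j"
    using free_position[OF q j(1)] by metis
  obtain p where p: "q dvd p" "m < p" "p \<le> m + q" using multiple_in_window[OF q_pos] by blast
  have "b j \<le> 1" "c j \<le> 1" using is_digit_sequence_le_1 b c j(1) by blast+
  have gap: "1 / 2 ^ p \<le> \<bar>u - v\<bar>"
  proof -
    have agree: "weave b k = weave c k" if "1 \<le> k" "k < m" for k
    proof (cases "free k")
      case True
      hence "rank k \<ge> 1" using that(1) by (rule rank_pos)
      thus ?thesis using j(3)[of "rank k"] m(4)[of k] that by (simp add: weave_def)
    qed (auto simp: free_def weave_def)
    have at_p: "weave b p = weave c p" using p by (simp add: weave_def)
    have at_m: "weave b m = b j" "weave c m = c j" using m by (auto simp: weave_def free_def)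
    consider "b j = 0" "c j = 1" | "b j = 1" "c j = 0"
      using j(2) \<open>b j \<le> 1\<close> \<open>c j \<le> 1\<close> by linarith
    thus ?thesis
    proof cases
      case 1
      have "1 / 2 ^ p \<le> v - u"
        by (rule digit_sequence_gap[OF u v, of m]) (use agree at_p at_m 1 m p in auto)
      thus ?thesis by linarith
    next
      case 2
      have "1 / 2 ^ p \<le> u - v"
        by (rule digit_sequence_gap[OF v u, of m]) (use agree at_p at_m 2 m p in auto)
      thus ?thesis by linarith
    qed
  qed
  have s1: "s \<le> 1"
  proof (rule ccontr)
    assume "\<not> s \<le> 1"
    hence "real q * 1 \<le> real q * s" by (intro mult_left_mono) auto
    thus False using s by simp
  qed
  have rank: "s * real m \<le> real j"
  proof -
    have "real q * real m \<le> real q * real j + 2 * real m"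
      using rank_ge[of m] m(3) by (metis of_nat_add of_nat_le_iff of_nat_mult of_nat_numeral)
    moreover have "(real q * s) * real m \<le> (real q - 2) * real m" using s(2) by (rule mult_right_mono) simp
    ultimately have "real q * (s * real m) \<le> real q * real j" by (simp add: algebra_simps)
    thus ?thesis using q_pos by simp
  qed
  have powr_neg: "2 powr (- real i) = 1 / 2 ^ i" for i
    by (simp add: powr_minus_divide powr_realpow)
  have "\<bar>y - z\<bar> \<le> 1 / 2 ^ (j - 1)"
    by (rule digit_sequence_close[OF b c]) (use j in auto)
  also have "\<dots> = 2 * 2 powr (- real j)"
    using j(1) by (cases j) (simp_all only: powr_neg, simp_all)
  also have "\<dots> \<le> 2 * (2 ^ q * 2 powr (- (real p * s)))"
  proof -
    have "real p * s \<le> (real m + real q) * s" using p(3) s(1) by (intro mult_right_mono) auto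
    also have "\<dots> \<le> real j + real q"
      using rank mult_left_mono[OF s1, of "real q"] by (simp add: algebra_simps)
    finally have "- real j \<le> real q + (- (real p * s))" by simp
    hence "2 powr (- real j) \<le> 2 powr (real q + (- (real p * s)))" by (intro powr_mono) auto
    thus ?thesis unfolding powr_add by (simp add: powr_realpow)
  qed
  also have "2 powr (- (real p * s)) = (1 / 2 ^ p) powr s"
    unfolding powr_neg[symmetric] by (simp add: powr_powr)
  also have "2 * (2 ^ q * (1 / 2 ^ p) powr s) \<le> 2 * (2 ^ q * \<bar>u - v\<bar> powr s)"
    using gap s(1) by (intro mult_left_mono powr_mono2) auto
  finally show ?thesis by (simp add: mult_ac)
qed

lemma weave_liminf_limsup:
  fixes \<phi> :: "nat \<Rightarrow> real"
  assumes pos: "\<And>n. n \<ge> 1 \<Longrightarrow> \<phi> n > 0"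
    and low: "\<And>k. real (Suc k) * real (N k + q) \<le> \<phi> (M k)"
    and high: "\<And>k. real (Suc k) * \<phi> (N (Suc k)) \<le> real (L k)"
    and a: "\<And>k. k \<ge> 1 \<Longrightarrow> a k = weave b k"
  shows "liminf (\<lambda>n. ereal (real (run_length a n) / \<phi> n)) = 0"
    and "limsup (\<lambda>n. ereal (real (run_length a n) / \<phi> n)) = \<infinity>"
proof -
  let ?f = "\<lambda>n. ereal (real (run_length a n) / \<phi> n)"
  have "0 \<le> liminf ?f"
  proof (rule Liminf_bounded)
    show "\<forall>\<^sub>F n in sequentially. 0 \<le> ?f n"
      using eventually_ge_at_top[of 1] by eventually_elim (use pos in \<open>simp add: less_imp_le\<close>)
  qed
  moreover have "liminf ?f \<le> 0"
  proof -
    have upper: "real (run_length a (M k)) / \<phi> (M k) \<le> 1 / real (Suc k)" for k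
    proof -
      have "M k \<ge> 1" using N_M[of k] q_pos by linarith
      have "real (Suc k) * real (run_length a (M k)) \<le> real (Suc k) * real (N k + q)"
        using run_length_weave_le[of a b k] a by (intro mult_left_mono) auto
      also have "\<dots> \<le> \<phi> (M k)" by (rule low)
      finally show ?thesis using pos[OF \<open>M k \<ge> 1\<close>] by (simp add: field_simps)
    qed
    have "liminf ?f \<le> liminf (?f \<circ> M)"
      by (rule liminf_subseq_mono[OF strict_mono_M])
    also have "\<dots> \<le> liminf (\<lambda>k. ereal (1 / real (Suc k)))"
      by (intro Liminf_mono always_eventually) (use upper in auto)
    also have "\<dots> = 0"
      using lim_imp_Liminf[OF sequentially_bot, of "\<lambda>k. ereal (1 / real (Suc k))" "ereal 0"]
        LIMSEQ_Suc[OF lim_1_over_n] by (simp add: zero_ereal_def del: ereal_eq_0)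
    finally show ?thesis .
  qed
  ultimately show "liminf ?f = 0" by simp
  have "limsup (\<lambda>k. ereal (real (Suc k))) \<le> limsup (?f \<circ> (\<lambda>k. N (Suc k)))"
  proof (intro Limsup_mono always_eventually allI)
    fix k
    have "N (Suc k) \<ge> 1" using le_N[of "Suc k"] by simp
    moreover have "real (Suc k) * \<phi> (N (Suc k)) \<le> real (run_length a (N (Suc k)))"
      using high[of k] run_length_weave_ge[of a b k] a by force
    ultimately show "ereal (real (Suc k)) \<le> (?f \<circ> (\<lambda>k. N (Suc k))) k"
      using pos by (simp add: pos_le_divide_eq)
  qed
  also have "\<dots> \<le> limsup ?f"
    by (rule limsup_subseq_mono) (use strict_mono_N in \<open>auto simp: strict_mono_def\<close>)
  also have "limsup (\<lambda>k. ereal (real (Suc k))) = \<infinity>"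
  proof (rule lim_imp_Limsup)
    have "filterlim (\<lambda>k. real (Suc k)) at_top sequentially"
      using filterlim_real_sequentially by (rule filterlim_compose[OF _ filterlim_Suc])
    thus "((\<lambda>k. ereal (real (Suc k))) \<longlongrightarrow> \<infinity>) sequentially"
      by (simp add: tendsto_PInfty_eq_at_top)
  qed simp
  finally show "limsup ?f = \<infinity>" by simp
qed

end

section \<open>Choosing the runs\<close>

text \<open>
  The blocks are chosen one after the other. Given the end \<open>N\<close> of the last block, divergence of
  \<open>\<phi>\<close> gives the time \<open>M\<close>, and only afterwards is the end \<open>n\<close> of the next block taken so large
  that both \<open>n\<close> and \<open>n / \<phi> n\<close> exceed given bounds depending on \<open>M\<close> and \<open>k\<close>. The block length \<open>L\<close> is
  the least that makes \<open>L / \<phi> n\<close> at least \<open>Suc k\<close>, so \<open>L\<close> is a small fraction of \<open>n\<close>.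
\<close>
lemma sparse_runs_exist:
  fixes \<phi> :: "nat \<Rightarrow> real"
  assumes pos: "\<And>n. n \<ge> 1 \<Longrightarrow> \<phi> n > 0"
    and lim: "filterlim \<phi> at_top sequentially"
    and limsup: "limsup (\<lambda>n. ereal (real n / \<phi> n)) = \<infinity>"
    and q: "q > 0"
  obtains N M L where "sparse_runs q N M L"
    "\<And>k. real (Suc k) * real (N k + q) \<le> \<phi> (M k)"
    "\<And>k. real (Suc k) * \<phi> (N (Suc k)) \<le> real (L k)"
proof -
  define step where "step k N n \<longleftrightarrow> (\<exists>M L. N + q \<le> M \<and> M + L \<le> n \<and> L > 0 \<and> q * (N + L) + L \<le> n
      \<and> real (Suc k) * real (N + q) \<le> \<phi> M \<and> real (Suc k) * \<phi> n \<le> real L)" for k N n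
  have "\<exists>n. step k N n" for k N
  proof -
    have "\<forall>\<^sub>F M in sequentially. real (Suc k) * real (N + q) \<le> \<phi> M \<and> N + q \<le> M"
      using filterlim_at_top[THEN iffD1, OF lim] eventually_ge_at_top by (intro eventually_conj) auto
    then obtain M where M: "real (Suc k) * real (N + q) \<le> \<phi> M" "N + q \<le> M"
      using eventually_happens'[OF sequentially_bot] by blast
    \<comment> \<open>The aim is \<open>(q + 1) * (L + 1 + M) \<le> n\<close>, which implies all upper bounds on \<open>L\<close>; the factor 2
      in \<open>A\<close> lets \<open>L\<close> and the remaining terms take up half of \<open>n\<close> each.\<close>
    define A where "A = 2 * (real q + 1)"
    have "\<exists>\<^sub>F n in sequentially. ereal (A * real (Suc k)) < ereal (real n / \<phi> n)"
    proof (rule ccontr)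
      assume "\<not> ?thesis"
      hence "limsup (\<lambda>n. ereal (real n / \<phi> n)) \<le> ereal (A * real (Suc k))"
        by (intro Limsup_bounded) (simp add: not_frequently not_less)
      thus False using limsup by simp
    qed
    then obtain n where n: "ereal (A * real (Suc k)) < ereal (real n / \<phi> n)"
      "n \<ge> nat \<lceil>A * (2 + real M)\<rceil>"
      using eventually_ge_at_top[of "nat \<lceil>A * (2 + real M)\<rceil>"]
      by (metis (mono_tags, lifting) eventually_mono frequently_def)
    have nM: "A * (2 + real M) \<le> real n" using n(2) by linarith
    have "A > 0" by (simp add: A_def)
    hence "A * (2 + real M) > 0" by simp
    hence "n \<ge> 1" using nM by (cases n) auto
    have phi: "\<phi> n > 0" using pos \<open>n \<ge> 1\<close> by simp
    have n\<phi>: "A * (real (Suc k) * \<phi> n) \<le> real n"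
      using n(1) phi by (simp add: field_simps)
    define L where "L = nat \<lceil>real (Suc k) * \<phi> n\<rceil>"
    have kphi: "real (Suc k) * \<phi> n > 0" using phi by simp
    hence L: "L > 0" "real (Suc k) * \<phi> n \<le> real L" "real L \<le> real (Suc k) * \<phi> n + 1"
      unfolding L_def by linarith+
    have "A * real L + A * (1 + real M) \<le> A * (real (Suc k) * \<phi> n) + A * (2 + real M)"
      using mult_left_mono[OF L(3), of A] \<open>A > 0\<close> by (simp add: algebra_simps)
    hence "A * real L + A * (1 + real M) \<le> 2 * real n" using n\<phi> nM by linarith
    hence "real ((q + 1) * (L + 1 + M)) \<le> real n"
      by (simp add: A_def algebra_simps)
    hence main: "(q + 1) * (L + 1 + M) \<le> n" by (simp only: of_nat_le_iff)
    have "q * (N + L) \<le> q * (L + 1 + M)" using M(2) by (intro mult_left_mono) auto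
    hence "q * (N + L) + L \<le> n" "M + L \<le> n" using main by (auto simp: algebra_simps)
    thus ?thesis unfolding step_def using M L by blast
  qed
  then obtain F where F: "\<And>k N. step k N (F k N)" by metis
  define N where "N = rec_nat 0 F"
  have "step k (N k) (N (Suc k))" for k using F by (simp add: N_def)
  then obtain M L where NML: "\<And>k. N k + q \<le> M k \<and> M k + L k \<le> N (Suc k) \<and> L k > 0
      \<and> q * (N k + L k) + L k \<le> N (Suc k)
      \<and> real (Suc k) * real (N k + q) \<le> \<phi> (M k) \<and> real (Suc k) * \<phi> (N (Suc k)) \<le> real (L k)"
    unfolding step_def by metis
  have "sparse_runs q N M L"
    by unfold_locales (use NML q in \<open>auto simp: N_def\<close>)
  thus ?thesis using that NML by blast
qed

section \<open>The dimension of the exceptional set\<close>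

lemma hausdorff_measure_E_max_pos:
  fixes d :: "real \<Rightarrow> nat \<Rightarrow> nat" and \<phi> :: "nat \<Rightarrow> real"
  assumes digits: "\<And>x. x \<in> {0..1} \<Longrightarrow> is_digit_sequence (d x) x"
    and pos: "\<And>n. n \<ge> 1 \<Longrightarrow> \<phi> n > 0"
    and lim: "filterlim \<phi> at_top sequentially"
    and limsup: "limsup (\<lambda>n. ereal (real n / \<phi> n)) = \<infinity>"
    and s: "0 \<le> s" "s < 1"
  shows "hausdorff_measure s (E_max d \<phi>) \<noteq> 0"
proof -
  \<comment> \<open>Large enough for \<open>s \<le> 1 - 2 / q\<close>, and above 2 even for \<open>s = 0\<close>.\<close>
  define q where "q = nat \<lceil>2 / (1 - s)\<rceil> + 3"
  have "2 / (1 - s) \<le> real q" unfolding q_def by linarith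
  hence qs: "real q * s \<le> real q - 2" using s by (simp add: field_simps)
  have q: "q > 2" by (simp add: q_def)
  obtain N M L where runs: "sparse_runs q N M L"
    and low: "\<And>k. real (Suc k) * real (N k + q) \<le> \<phi> (M k)"
    and high: "\<And>k. real (Suc k) * \<phi> (N (Suc k)) \<le> real (L k)"
    using sparse_runs_exist[OF pos lim limsup, of q] q by auto
  interpret sparse_runs q N M L by (rule runs)
  have "\<exists>x. x \<in> {0..1} \<and> is_digit_sequence (weave (d y)) x" if "y \<in> {0..1}" for y
    using digit_sequence_exists weave_digit[OF digits[OF that]] by metis
  then obtain h where h: "\<And>y. y \<in> {0..1} \<Longrightarrow> h y \<in> {0..1}"
    "\<And>y. y \<in> {0..1} \<Longrightarrow> is_digit_sequence (weave (d y)) (h y)" by metis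
  have "h y \<in> E_max d \<phi>" if y: "y \<in> {0..1}" for y
  proof -
    have "d (h y) k = weave (d y) k" if "k \<ge> 1" for k
      using digit_sequence_unique[OF h(2)[OF y] digits[OF h(1)[OF y]]
          weave_zeros_infinite weave_ones_infinite that] by simp
    thus ?thesis
      using weave_liminf_limsup[OF pos low high, of "d (h y)" "d y"] h(1)[OF y]
      by (simp add: E_max_def)
  qed
  thus ?thesis
    using weave_hoelder[OF digits digits h(2) h(2) s(1) qs q] s(1)
    by (intro hausdorff_measure_pos_of_hoelder_inverse[of "2 * 2 ^ q" h]) (auto simp: dist_real_def)
qed

lemma E_max_empty:
  fixes \<phi> :: "nat \<Rightarrow> real"
  assumes pos: "\<And>n. n \<ge> 1 \<Longrightarrow> \<phi> n > 0"
    and "limsup (\<lambda>n. ereal (real n / \<phi> n)) < \<infinity>"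
  shows "E_max d \<phi> = {}"
proof -
  have "limsup (\<lambda>n. ereal (real (run_length (d x) n) / \<phi> n)) < \<infinity>" for x
  proof -
    have "limsup (\<lambda>n. ereal (real (run_length (d x) n) / \<phi> n)) \<le> limsup (\<lambda>n. ereal (real n / \<phi> n))"
    proof (rule Limsup_mono)
      have le: "run_length (d x) n \<le> n" for n by (rule run_length_le) simp
      show "\<forall>\<^sub>F n in sequentially. ereal (real (run_length (d x) n) / \<phi> n) \<le> ereal (real n / \<phi> n)"
        using eventually_ge_at_top[of 1]
        by eventually_elim (use pos le in \<open>auto intro!: divide_right_mono simp: less_imp_le\<close>)
    qed
    thus ?thesis using assms(2) by (rule order_le_less_trans)
  qed
  thus ?thesis by (force simp: E_max_def)
qed

theorem theorem1p2:
  fixes d :: "real \<Rightarrow> nat \<Rightarrow> nat" and \<phi> :: "nat \<Rightarrow> real"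
  assumes digits: "\<And>x. x \<in> {0..1} \<Longrightarrow> is_digit_sequence (d x) x"
    and pos: "\<And>n. n \<ge> 1 \<Longrightarrow> \<phi> n > 0"
    and mono: "mono_on {1..} \<phi>"
    and lim: "filterlim \<phi> at_top sequentially"
  shows "(limsup (\<lambda>n. ereal (real n / \<phi> n)) = \<infinity> \<longrightarrow> hausdorff_dim (E_max d \<phi>) = 1) \<and>
         (limsup (\<lambda>n. ereal (real n / \<phi> n)) < \<infinity> \<longrightarrow> hausdorff_dim (E_max d \<phi>) = 0)"
proof (intro conjI impI)
  assume limsup: "limsup (\<lambda>n. ereal (real n / \<phi> n)) = \<infinity>"
  show "hausdorff_dim (E_max d \<phi>) = 1"
  proof (rule antisym)
    show "hausdorff_dim (E_max d \<phi>) \<le> 1"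
      by (rule hausdorff_dim_unit_interval_le_1) (auto simp: E_max_def)
    show "1 \<le> hausdorff_dim (E_max d \<phi>)"
      unfolding hausdorff_dim_def
    proof (rule INF_greatest)
      fix s assume s: "s \<in> {s. 0 \<le> s \<and> hausdorff_measure s (E_max d \<phi>) = 0}"
      hence "\<not> s < 1" using hausdorff_measure_E_max_pos[OF digits pos lim limsup, of s] by auto
      thus "1 \<le> ennreal s" by simp
    qed
  qed
next
  assume "limsup (\<lambda>n. ereal (real n / \<phi> n)) < \<infinity>"
  thus "hausdorff_dim (E_max d \<phi>) = 0"
    using E_max_empty[OF pos] hausdorff_dim_empty by simp
qed

end
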